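(* Let $(x^{k},\eta^{k},z^k,\mu^k)$ be generated from arbitrary $z^0,\mu^0\in\mathbb{R}^{d_z}$ by the ADMM iterations, for $k\ge 0$, $$\begin{bmatrix}x^{k+1}\\ \eta^{k+1}\end{bmatrix}=-\begin{bmatrix}Q+\rho I & A^T\\ A&0\end{bmatrix}^{-1}\begin{bmatrix}p-\rho(z^k-\mu^k)\\ -b\end{bmatrix},\qquad z^{k+1}=\Pi(x^{k+1}+\mu^k),\qquad \mu^{k+1}=\mu^k+x^{k+1}-z^{k+1}.$$ Let $v^k=x^{k+1}+\mu^k$ and $\tilde v^k=(v^k,\eta^{k+1})$. Then the ADMM iterations can be cast as a fixed-point iteration $\tilde v^{k+1}=F(\tilde v^k)$ (for the fixed-point equation $F(\tilde v)=\tilde v$), namely, for all $k\ge 0$, $$\begin{bmatrix}v^{k+1}\\ \eta^{k+2}\end{bmatrix}=-\begin{bmatrix}Q+\rho I & A^T\\ A&0\end{bmatrix}^{-1}\begin{bmatrix}p-\rho(2\Pi(v^k)-v^k)\\ -b\end{bmatrix}+\begin{bmatrix}v^k\\ \eta^{k+1}\end{bmatrix}-\begin{bmatrix}\Pi(v^k)\\ \eta^{k+1}\end{bmatrix}.$$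
   Context: Consider the quadratic program: minimize $\tfrac12 z^TQz+z^Tp$ over $z\in\mathbb{R}^{d_z}$ subject to $Az=b$ and $l\le z\le u$ (componentwise). Here $Q\in\mathbb{R}^{d_z\times d_z}$ is symmetric positive definite, $p,l,u\in\mathbb{R}^{d_z}$ with $l\le u$, $A\in\mathbb{R}^{d_{eq}\times d_z}$, $b\in\mathbb{R}^{d_{eq}}$; all these data may depend on a parameter $\theta$, which is held fixed here. $\rho>0$ is the ADMM penalty parameter, $I$ is the $d_z\times d_z$ identity, and the matrix $\begin{bmatrix}Q+\rho I&A^T\\ A&0\end{bmatrix}$ is assumed nonsingular. $\Pi:\mathbb{R}^{d_z}\to\mathbb{R}^{d_z}$ is the Euclidean projection onto the box: $\Pi(x)_j=l_j$ if $x_j<l_j$, $\Pi(x)_j=x_j$ if $l_j\le x_j\le u_j$, and $\Pi(x)_j=u_j$ if $x_j>u_j$. The map $F:\mathbb{R}^{d_z}\times\mathbb{R}^{d_{eq}}\to\mathbb{R}^{d_z}\times\mathbb{R}^{d_{eq}}$ is $$F(v,\eta)=-\begin{bmatrix}Q+\rho I & A^T\\ A&0\end{bmatrix}^{-1}\begin{bmatrix}p-\rho(2\Pi(v)-v)\\ -b\end{bmatrix}+\begin{bmatrix}v\\ \eta\end{bmatrix}-\begin{bmatrix}\Pi(v)\\ \eta\end{bmatrix}.$$ *)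

theory Defs
  imports "HOL-Analysis.Analysis"
begin

text \<open>Block vectors and block matrices are indexed by the disjoint sum of the index types.\<close>

definition stack :: "real ^ 'n \<Rightarrow> real ^ 'm \<Rightarrow> real ^ ('n + 'm)" where
  "stack v w = (\<chi> i. case i of Inl a \<Rightarrow> v $ a | Inr b \<Rightarrow> w $ b)"

definition unstack :: "real ^ ('n + 'm) \<Rightarrow> (real ^ 'n) \<times> (real ^ 'm)" where
  "unstack y = (\<chi> a. y $ Inl a, \<chi> b. y $ Inr b)"

lemma unstack_stack [simp]: "unstack (stack v w) = (v, w)"
  by (simp add: unstack_def stack_def vec_eq_iff)

lemma stack_unstack [simp]: "stack (fst (unstack y)) (snd (unstack y)) = y"
  by (simp add: unstack_def stack_def vec_eq_iff split: sum.split)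

definition block_matrix ::
  "real ^ 'n ^ 'k \<Rightarrow> real ^ 'm ^ 'k \<Rightarrow> real ^ 'n ^ 'l \<Rightarrow> real ^ 'm ^ 'l \<Rightarrow> real ^ ('n + 'm) ^ ('k + 'l)"
where
  "block_matrix P R S T = (\<chi> i j. case i of
      Inl a \<Rightarrow> (case j of Inl c \<Rightarrow> P $ a $ c | Inr d \<Rightarrow> R $ a $ d)
    | Inr b \<Rightarrow> (case j of Inl c \<Rightarrow> S $ b $ c | Inr d \<Rightarrow> T $ b $ d))"

lemma block_matrix_mult_stack:
  fixes P :: "real ^ 'n::finite ^ 'k::finite" and R :: "real ^ 'm::finite ^ 'k"
    and S :: "real ^ 'n ^ 'l::finite" and T :: "real ^ 'm ^ 'l"
  shows "block_matrix P R S T *v stack v w = stack (P *v v + R *v w) (S *v v + T *v w)"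
  by (simp add: vec_eq_iff block_matrix_def stack_def matrix_vector_mult_def
      UNIV_Plus_UNIV [symmetric] sum.Plus split: sum.split del: UNIV_Plus_UNIV)

definition positive_definite :: "real ^ 'n ^ 'n \<Rightarrow> bool" where
  "positive_definite Q \<longleftrightarrow> (\<forall>x. x \<noteq> 0 \<longrightarrow> x \<bullet> (Q *v x) > 0)"

definition box_proj :: "real ^ 'n \<Rightarrow> real ^ 'n \<Rightarrow> real ^ 'n \<Rightarrow> real ^ 'n" where
  "box_proj l u x = (\<chi> j. if x $ j < l $ j then l $ j else if x $ j \<le> u $ j then x $ j else u $ j)"

lemma box_proj_eq_closest_point:
  fixes l u x :: "real ^ 'n"
  assumes "\<And>j. l $ j \<le> u $ j"
  shows "box_proj l u x = closest_point (cbox l u) x"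
proof (rule closest_point_unique)
  show "convex (cbox l u)" "closed (cbox l u)"
    by auto
  show "box_proj l u x \<in> cbox l u"
    using assms by (auto simp: mem_box_cart box_proj_def)
  show "\<forall>y\<in>cbox l u. dist x (box_proj l u x) \<le> dist x y"
  proof
    fix y assume y: "y \<in> cbox l u"
    have "norm ((x - box_proj l u x) $ i) \<le> norm ((x - y) $ i)" for i
    proof -
      have "l $ i \<le> y $ i" "y $ i \<le> u $ i"
        using y by (auto simp: mem_box_cart)
      then show ?thesis
        by (auto simp: box_proj_def)
    qed
    then show "dist x (box_proj l u x) \<le> dist x y"
      by (simp add: dist_norm norm_le_componentwise_cart)
  qed
qed

definition kkt_matrix :: "real ^ 'n ^ 'n \<Rightarrow> real ^ 'n ^ 'm \<Rightarrow> real \<Rightarrow> real ^ ('n + 'm) ^ ('n + 'm)" where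
  "kkt_matrix Q A \<rho> = block_matrix (Q + \<rho> *\<^sub>R mat 1) (transpose A) A 0"

definition admm_map ::
  "real ^ 'n ^ 'n \<Rightarrow> real ^ 'n \<Rightarrow> real ^ 'n ^ 'm \<Rightarrow> real ^ 'm \<Rightarrow> real ^ 'n \<Rightarrow> real ^ 'n \<Rightarrow> real
    \<Rightarrow> (real ^ 'n) \<times> (real ^ 'm) \<Rightarrow> (real ^ 'n) \<times> (real ^ 'm)"
where
  "admm_map Q p A b l u \<rho> = (\<lambda>(v, \<eta>).
      unstack (- (matrix_inv (kkt_matrix Q A \<rho>) *v
                    stack (p - \<rho> *\<^sub>R (2 *\<^sub>R box_proj l u v - v)) (- b)))
      + (v, \<eta>) - (box_proj l u v, \<eta>))"

end

theory Submission
  imports Defs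
begin

text \<open>
  The \<open>\<mu>\<close>-update splits \<open>v k = x (k + 1) + \<mu> k\<close> into projection and residual: since
  \<open>z (k + 1)\<close> is the projection \<open>\<Pi> (v k)\<close>, the new multiplier \<open>\<mu> (k + 1)\<close> is the residual
  \<open>v k - \<Pi> (v k)\<close>. So \<open>v k\<close> alone determines both quantities that enter the next linear
  solve, and \<open>z (k + 1) - \<mu> (k + 1) = 2 \<Pi> (v k) - v k\<close> is the reflection of \<open>v k\<close>. The solve
  thus returns \<open>x (k + 2)\<close> and \<open>\<eta> (k + 2)\<close>, and adding the same residual to \<open>x (k + 2)\<close> gives
  \<open>v (k + 1)\<close>. The \<open>\<eta>\<close>-component carries no memory: it is added and subtracted again, which
  only serves to write the iteration in fixed-point form on the product space.
\<close>

lemma unstack_add: "unstack (y + y') = unstack y + unstack y'"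
  by (simp add: unstack_def vec_eq_iff)

lemma stack_add: "stack v w + stack v' w' = stack (v + v') (w + w')"
  by (simp add: stack_def vec_eq_iff split: sum.split)

lemma stack_diff: "stack v w - stack v' w' = stack (v - v') (w - w')"
  by (simp add: stack_def vec_eq_iff split: sum.split)

text \<open>This passes between the two forms of the iteration, on pairs and on stacked vectors.\<close>

lemma admm_map_eq_unstack:
  "admm_map Q p A b l u \<rho> (v, \<eta>) =
    unstack (- (matrix_inv (kkt_matrix Q A \<rho>) *v
                 stack (p - \<rho> *\<^sub>R (2 *\<^sub>R box_proj l u v - v)) (- b))
             + stack v \<eta> - stack (box_proj l u v) \<eta>)"
  by (simp only: admm_map_def prod.case add_diff_eq [symmetric] stack_diff unstack_add
      unstack_stack diff_Pair)

theorem proposition1: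
  fixes Q :: "real ^ 'n ^ 'n" and p l u :: "real ^ 'n"
    and A :: "real ^ 'n ^ 'm" and b :: "real ^ 'm" and \<rho> :: real
    and x z \<mu> v :: "nat \<Rightarrow> real ^ 'n" and \<eta> :: "nat \<Rightarrow> real ^ 'm"
    and vt :: "nat \<Rightarrow> (real ^ 'n) \<times> (real ^ 'm)"
  assumes "transpose Q = Q" and "positive_definite Q"
    and "\<And>j. l $ j \<le> u $ j"
    and "\<rho> > 0"
    and "invertible (kkt_matrix Q A \<rho>)"
    and x_\<eta>_step: "\<And>k. stack (x (k + 1)) (\<eta> (k + 1)) =
          - (matrix_inv (kkt_matrix Q A \<rho>) *v stack (p - \<rho> *\<^sub>R (z k - \<mu> k)) (- b))"
    and z_step: "\<And>k. z (k + 1) = box_proj l u (x (k + 1) + \<mu> k)"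
    and \<mu>_step: "\<And>k. \<mu> (k + 1) = \<mu> k + x (k + 1) - z (k + 1)"
    and v: "\<And>k. v k = x (k + 1) + \<mu> k"
    and vt: "\<And>k. vt k = (v k, \<eta> (k + 1))"
  shows "\<forall>k. vt (k + 1) = admm_map Q p A b l u \<rho> (vt k) \<and>
           stack (v (k + 1)) (\<eta> (k + 2)) =
             - (matrix_inv (kkt_matrix Q A \<rho>) *v
                  stack (p - \<rho> *\<^sub>R (2 *\<^sub>R box_proj l u (v k) - v k)) (- b))
             + stack (v k) (\<eta> (k + 1)) - stack (box_proj l u (v k)) (\<eta> (k + 1))"
proof
  fix k
  let ?P = "box_proj l u (v k)"
  let ?s = "- (matrix_inv (kkt_matrix Q A \<rho>) *v
                 stack (p - \<rho> *\<^sub>R (2 *\<^sub>R ?P - v k)) (- b))"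
  have z: "z (k + 1) = ?P"
    using z_step v by simp
  have \<mu>: "\<mu> (k + 1) = v k - ?P"
    using \<mu>_step [of k] v [of k] z by (simp add: algebra_simps)
  have "z (k + 1) - \<mu> (k + 1) = 2 *\<^sub>R ?P - v k"
    by (simp only: z \<mu>) (simp add: scaleR_2)
  then have solve: "stack (x (k + 2)) (\<eta> (k + 2)) = ?s"
    using x_\<eta>_step [of "k + 1"] by simp
  have "v (k + 1) = x (k + 2) + (v k - ?P)"
    using v [of "k + 1"] \<mu> by simp
  then have stacked: "stack (v (k + 1)) (\<eta> (k + 2)) =
      ?s + stack (v k) (\<eta> (k + 1)) - stack ?P (\<eta> (k + 1))"
    by (simp only: solve [symmetric] stack_add stack_diff) (simp add: algebra_simps)
  have "vt (k + 1) = unstack (stack (v (k + 1)) (\<eta> (k + 2)))"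
    using vt [of "k + 1"] by simp
  also have "\<dots> = admm_map Q p A b l u \<rho> (vt k)"
    by (simp only: stacked vt admm_map_eq_unstack)
  finally show "vt (k + 1) = admm_map Q p A b l u \<rho> (vt k) \<and>
      stack (v (k + 1)) (\<eta> (k + 2)) =
        ?s + stack (v k) (\<eta> (k + 1)) - stack ?P (\<eta> (k + 1))"
    using stacked by blast
qed

end
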